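(* Let $A\in\mathbb{R}^{m\times n}$, $m\ge n$, have full column rank, let $\mathbf{b}\in\mathbb{R}^m$, let $W\in\mathbb{R}^{m\times m}$ be symmetric positive definite, and let $L\in\mathbb{R}^{n\times k}$, $k\le n$. Let $\mathbf{x}=A_{W,I_n}^{\dagger}\mathbf{b}$ and assume all components of $L^{\mathrm T}\mathbf{x}$ are nonzero. Equip the solution space $\mathbb{R}^k$ with the componentwise norm $$\|\mathbf{u}\|_c=\min\{\omega:\ |u_i|\le\omega\,|(L^{\mathrm T}\mathbf{x})_i|,\ i=1,\dots,k\}=\max_{1\le i\le k}|u_i|/|(L^{\mathrm T}\mathbf{x})_i|.$$ Then the corresponding componentwise condition number $\mathcal{K}_c$ of the weighted least squares solution map $g(A,\mathbf{b})=L^{\mathrm T}(A^{\mathrm T}WA)^{-1}A^{\mathrm T}W\mathbf{b}$ at $(A,\mathbf{b})$ has the three expressions $$\begin{aligned}\mathcal{K}_c&=\big\|D_{L^{\mathrm T}\mathbf{x}}^{-1}L^{\mathrm T}[\,VD_A\ \ A_{W,I_n}^{\dagger}D_{\mathbf{b}}\,]\big\|_\infty\\&=\Big\|\,|D_{L^{\mathrm T}\mathbf{x}}^{-1}|\big(|L^{\mathrm T}V|\,\mathrm{vec}(|A|)+|L^{\mathrm T}A_{W,I_n}^{\dagger}|\,|\mathbf{b}|\big)\Big\|_\infty\\&=\Big\|\sum_{j=1}^n\big|D_{L^{\mathrm T}\mathbf{x}}^{-1}L^{\mathrm T}(A^{\mathrm T}WA)^{-1}(\mathbf{e}_j\mathbf{d}^{\mathrm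 T}-x_jA^{\mathrm T}W)\big|\,|A(:,j)|+|D_{L^{\mathrm T}\mathbf{x}}^{-1}L^{\mathrm T}A_{W,I_n}^{\dagger}|\,|\mathbf{b}|\Big\|_\infty,\end{aligned}$$ where $V=(A^{\mathrm T}WA)^{-1}\otimes\mathbf{d}^{\mathrm T}-\mathbf{x}^{\mathrm T}\otimes A_{W,I_n}^{\dagger}$.
   Context: Notation: $A_{W,I_n}^{\dagger}=(A^{\mathrm T}WA)^{-1}A^{\mathrm T}W$; $\mathbf{d}=W(\mathbf{b}-A\mathbf{x})$; $\mathbf{e}_j$ is the $j$th unit vector of $\mathbb{R}^n$; $A(:,j)$ is the $j$th column of $A$; $|\cdot|$ is the entrywise absolute value; $\mathrm{vec}$ stacks the columns of a matrix; $D_A=\mathrm{diag}(\mathrm{vec}(A))$ and $D_{\mathbf{v}}=\mathrm{diag}(\mathbf{v})$ for a vector $\mathbf{v}$; $\otimes$ is the Kronecker product; $\|\cdot\|_\infty$ of a matrix is the operator norm induced by the vector infinity norm (maximum absolute row sum). Condition number: $W$ and $L$ are fixed and $g$ is a function of the data $(A,\mathbf{b})$. A perturbation $(\Delta A,\Delta\mathbf{b})\in\mathbb{R}^{m\times n}\times\mathbb{R}^m$ is admissible if each of its entries vanishes wherever the corresponding entry of $(A,\mathbf{b})$ vanishes. For admissible perturbations, the data norm is $\|(\Delta A,\Delta\mathbf{b})\|_c=\min\{\omega:\ |\Delta A|\le\omega|A|,\ |\Delta\mathbf{b}|\le\omega|\mathbf{b}|\}$ (entrywise). Then $\mathcal{K}_c=\max\{\|g'(A,\mathbf{b})\cdot(\Delta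 A,\Delta\mathbf{b})\|_c:\ (\Delta A,\Delta\mathbf{b})\text{ admissible},\ \|(\Delta A,\Delta\mathbf{b})\|_c=1\}$, where $g'$ is the Fréchet derivative and the first $\|\cdot\|_c$ is the componentwise norm on $\mathbb{R}^k$. *)

theory Defs
  imports "HOL-Analysis.Analysis"
begin

text \<open>
  An \<open>m \<times> n\<close> real matrix is an element of \<open>real^'n^'m\<close>. On vectors and on matrices of this form,
  the library's \<open>\<bar>_\<bar>\<close> and \<open>\<le>\<close> are entrywise.
\<close>

subsection \<open>Matrix operations\<close>

definition diag_mat :: "real^'n \<Rightarrow> real^'n^'n" where
  "diag_mat v = (\<chi> i j. if i = j then v $ i else 0)"

text \<open>
  The coordinates of \<open>vec(A)\<close> are indexed by pairs \<open>(j, i)\<close> (column, then row) instead of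
  by the positions \<open>(j - 1) m + i\<close>. This agrees with the column index of \<open>B \<otimes>\<^sub>K C\<close> below, whose first
  component is the (block) column index of \<open>B\<close>.
\<close>

definition vec_cols :: "real^'n^'m \<Rightarrow> real^('n \<times> 'm)" where
  "vec_cols A = (\<chi> p. A $ snd p $ fst p)"

definition kron :: "real^'b^'a \<Rightarrow> real^'d^'c \<Rightarrow> real^('b \<times> 'd)^('a \<times> 'c)"  (infixl "\<otimes>\<^sub>K" 75) where
  "B \<otimes>\<^sub>K C = (\<chi> p q. B $ fst p $ fst q * C $ snd p $ snd q)"

text \<open>
  A Kronecker product with a single-row factor has its rows indexed by \<open>'a \<times> 1\<close> or \<open>1 \<times> 'a\<close>;
  the next two functions identify these index types with \<open>'a\<close>.
\<close>

definition rows_times_one :: "real^'b^('a \<times> 1) \<Rightarrow> real^'b^'a" where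
  "rows_times_one M = (\<chi> i. M $ (i, 1))"

definition rows_one_times :: "real^'b^(1 \<times> 'a) \<Rightarrow> real^'b^'a" where
  "rows_one_times M = (\<chi> i. M $ (1, i))"

definition hblock :: "real^'p^'r \<Rightarrow> real^'q^'r \<Rightarrow> real^('p + 'q)^'r" where
  "hblock B C = (\<chi> i s. case s of Inl p \<Rightarrow> B $ i $ p | Inr q \<Rightarrow> C $ i $ q)"

definition mat_infnorm :: "real^'n^'m \<Rightarrow> real" where
  "mat_infnorm M = (SUP v\<in>{v. infnorm v = 1}. infnorm (M *v v))"

definition sym_pos_def :: "real^'m^'m \<Rightarrow> bool" where
  "sym_pos_def W \<longleftrightarrow> transpose W = W \<and> (\<forall>v. v \<noteq> 0 \<longrightarrow> v \<bullet> (W *v v) > 0)"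

subsection \<open>Weighted least squares\<close>

definition wpinv :: "real^'m^'m \<Rightarrow> real^'n^'m \<Rightarrow> real^'m^'n" where
  "wpinv W A = matrix_inv (transpose A ** W ** A) ** transpose A ** W"

definition wls_map :: "real^'m^'m \<Rightarrow> real^'k^'n \<Rightarrow> (real^'n^'m) \<times> (real^'m) \<Rightarrow> real^'k" where
  "wls_map W L = (\<lambda>(A, b).
     (transpose L ** matrix_inv (transpose A ** W ** A) ** transpose A ** W) *v b)"

subsection \<open>Componentwise condition number\<close>

definition admissible ::
    "real^'n^'m \<Rightarrow> real^'m \<Rightarrow> real^'n^'m \<Rightarrow> real^'m \<Rightarrow> bool" where
  "admissible A b dA db \<longleftrightarrow>
     (\<forall>i j. A $ i $ j = 0 \<longrightarrow> dA $ i $ j = 0) \<and> (\<forall>i. b $ i = 0 \<longrightarrow> db $ i = 0)"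

definition data_norm ::
    "real^'n^'m \<Rightarrow> real^'m \<Rightarrow> real^'n^'m \<Rightarrow> real^'m \<Rightarrow> real" where
  "data_norm A b dA db = (LEAST \<omega>. \<bar>dA\<bar> \<le> \<omega> *\<^sub>R \<bar>A\<bar> \<and> \<bar>db\<bar> \<le> \<omega> *\<^sub>R \<bar>b\<bar>)"

text \<open>Here \<open>y\<close> is the reference vector relative to which \<open>u\<close> is measured.\<close>

definition comp_norm :: "real^'k \<Rightarrow> real^'k \<Rightarrow> real" where
  "comp_norm y u = (LEAST \<omega>. \<forall>i. \<bar>u $ i\<bar> \<le> \<omega> * \<bar>y $ i\<bar>)"

definition comp_cond ::
    "real^'k \<Rightarrow> ((real^'n^'m) \<times> (real^'m) \<Rightarrow> real^'k) \<Rightarrow> real^'n^'m \<Rightarrow> real^'m \<Rightarrow> real" where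
  "comp_cond y g A b =
     (GREATEST t. \<exists>dA db. admissible A b dA db \<and> data_norm A b dA db = 1 \<and>
        t = comp_norm y (frechet_derivative g (at (A, b)) (dA, db)))"

subsection \<open>The two norms as explicit maxima\<close>

lemma comp_norm_eq_Max:
  fixes y u :: "real^'k"
  assumes "\<And>i. y $ i \<noteq> 0"
  shows "comp_norm y u = Max (range (\<lambda>i. \<bar>u $ i\<bar> / \<bar>y $ i\<bar>))"
proof -
  have "(\<forall>i. \<bar>u $ i\<bar> \<le> \<omega> * \<bar>y $ i\<bar>) \<longleftrightarrow> Max (range (\<lambda>i. \<bar>u $ i\<bar> / \<bar>y $ i\<bar>)) \<le> \<omega>" for \<omega>
    using assms by (simp add: pos_divide_le_eq)
  then show ?thesis
    unfolding comp_norm_def by (auto intro: Least_equality)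
qed

lemma mat_infnorm_eq_Max_row_sum:
  fixes M :: "real^'n^'m"
  shows "mat_infnorm M = Max (range (\<lambda>i. \<Sum>j\<in>UNIV. \<bar>M $ i $ j\<bar>))" (is "_ = ?R")
proof -
  have le: "infnorm (M *v v) \<le> ?R" if "infnorm v = 1" for v
  proof -
    have "\<bar>(M *v v) $ i\<bar> \<le> ?R" for i
    proof -
      have "\<bar>v $ j\<bar> \<le> 1" for j
        using component_le_infnorm_cart[of v j] that by simp
      then have "\<bar>M $ i $ j * v $ j\<bar> \<le> \<bar>M $ i $ j\<bar>" for j
        by (simp add: abs_mult mult_left_le)
      then have "\<bar>(M *v v) $ i\<bar> \<le> (\<Sum>j\<in>UNIV. \<bar>M $ i $ j\<bar>)"
        unfolding matrix_vector_mult_def vec_lambda_beta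
        by (intro order_trans[OF sum_abs] sum_mono)
      also have "\<dots> \<le> ?R"
        by (intro Max_ge) auto
      finally show ?thesis .
    qed
    then show ?thesis
      unfolding infnorm_cart by (intro cSup_least) auto
  qed
  have "?R \<in> range (\<lambda>i. \<Sum>j\<in>UNIV. \<bar>M $ i $ j\<bar>)"
    by (intro Max_in) auto
  then obtain i where i: "?R = (\<Sum>j\<in>UNIV. \<bar>M $ i $ j\<bar>)"
    by blast
  define v :: "real^'n" where "v = (\<chi> j. if M $ i $ j < 0 then - 1 else 1)"
  have "\<bar>v $ j\<bar> = 1" for j
    by (simp add: v_def)
  then have v1: "infnorm v = 1"
    unfolding infnorm_cart by simp
  have "(M *v v) $ i = ?R"
    unfolding i matrix_vector_mult_def vec_lambda_beta by (intro sum.cong) (auto simp: v_def)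
  then have ge: "?R \<le> infnorm (M *v v)"
    using component_le_infnorm_cart[of "M *v v" i] by linarith
  show ?thesis
    unfolding mat_infnorm_def
  proof (rule cSup_eq_maximum)
    show "?R \<in> (\<lambda>v. infnorm (M *v v)) ` {v. infnorm v = 1}"
      using order_antisym[OF ge le[OF v1]] v1 by (intro image_eqI[of _ _ v]) simp_all
  qed (use le in auto)
qed

end

theory Submission
  imports Defs
begin

text \<open>
  The condition number depends on the map only through its derivative at \<open>(A, b)\<close>. Write this
  derivative as \<open>P vec(dA) + Q db\<close>. Over the unit perturbations, which lie on the boundary of
  the box \<open>\<bar>dA\<bar> \<le> \<bar>A\<bar>\<close>, \<open>\<bar>db\<bar> \<le> \<bar>b\<bar>\<close>, the \<open>r\<close>th component of the derivative has maximal modulus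
  \<open>c\<^sub>r = (\<bar>P\<bar> vec(\<bar>A\<bar>) + \<bar>Q\<bar> \<bar>b\<bar>)\<^sub>r\<close>, attained at a vertex of the box whose signs follow row \<open>r\<close> of \<open>P\<close>
  and \<open>Q\<close>. So the condition number is the maximum of \<open>c\<^sub>r / \<bar>y\<^sub>r\<bar>\<close> over \<open>r\<close>, where \<open>y\<close> is the reference
  vector of the solution space. This is \<open>comp_cond_eq_infnorm\<close>, valid for every map that is
  differentiable at nonzero data.

  For weighted least squares, \<open>wls_map_has_derivative\<close> computes the derivative. The solution at
  perturbed data is the old solution \<open>x\<close> plus \<open>(A'\<^sup>T W A')\<^sup>-\<^sup>1\<close> applied to \<open>A'\<^sup>T W (b' - A' x)\<close>. The
  second factor vanishes at \<open>(A, b)\<close>, so the matrix inverse only has to be continuous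
  (\<open>tendsto_matrix_inv\<close>), and the derivative is
  \<open>L\<^sup>T (A\<^sup>T W A)\<^sup>-\<^sup>1 (dA\<^sup>T d + A\<^sup>T W (db - dA x))\<close>. Written in terms of \<open>vec(dA)\<close>, its coefficients are
  \<open>P = L\<^sup>T V\<close> and \<open>Q = L\<^sup>T A\<^sup>\<dagger>\<close> with \<open>A\<^sup>\<dagger>\<close> the weighted pseudoinverse (\<open>kron_vec_cols_mult\<close>).

  The three expressions of the theorem are three ways to write the numbers \<open>c\<^sub>r / \<bar>y\<^sub>r\<bar>\<close>: as absolute row
  sums of a column-scaled matrix (\<open>mat_infnorm_hblock_diag\<close>), as an entrywise modulus applied to the
  moduli of the data, and as the latter sum grouped by the columns of \<open>A\<close> (\<open>mult_vec_cols\<close>).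
\<close>

section \<open>Matrix inversion and linear maps\<close>

lemma matrix_inv_cancel:
  fixes B :: "real^'n^'n"
  assumes "invertible B"
  shows "B ** matrix_inv B = mat 1" and "matrix_inv B ** B = mat 1"
  using someI_ex[OF assms[unfolded invertible_def]] by (simp_all add: matrix_inv_def)

lemma matrix_inv_unique:
  fixes B C :: "real^'n^'n"
  assumes "B ** C = mat 1"
  shows "matrix_inv B = C"
proof -
  have "invertible B"
    using assms by (auto simp: invertible_right_inverse)
  then have "matrix_inv B ** (B ** C) = C"
    by (simp add: matrix_mul_assoc matrix_inv_cancel)
  then show ?thesis
    using assms by simp
qed

text \<open>
  Cramer's rule writes every entry of the inverse as a quotient of determinants. This reduces the
  continuity of inversion to the continuity of polynomials.
\<close>

lemma matrix_inv_entry_cramer: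
  fixes B :: "real^'n^'n"
  assumes "det B \<noteq> 0"
  shows "matrix_inv B = (\<chi> k l. det (\<chi> i j. if j = k then axis l 1 $ i else B $ i $ j) / det B)"
proof -
  have inv: "invertible B"
    using assms by (simp add: invertible_det_nz)
  have "matrix_inv B $ k $ l = det (\<chi> i j. if j = k then axis l 1 $ i else B $ i $ j) / det B" for k l
  proof -
    have "B *v (matrix_inv B *v axis l 1) = axis l 1"
      by (simp add: matrix_vector_mul_assoc matrix_inv_cancel[OF inv])
    then have "matrix_inv B *v axis l 1
        = (\<chi> k. det (\<chi> i j. if j = k then axis l 1 $ i else B $ i $ j) / det B)"
      using cramer[OF assms] by blast
    then have "(matrix_inv B *v axis l 1) $ k
        = det (\<chi> i j. if j = k then axis l 1 $ i else B $ i $ j) / det B"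
      by simp
    then show ?thesis
      by (simp add: matrix_vector_mult_basis column_def)
  qed
  then show ?thesis
    by (simp add: vec_eq_iff)
qed

lemma tendsto_det [tendsto_intros]:
  fixes f :: "'a \<Rightarrow> real^'n^'n"
  assumes "(f \<longlongrightarrow> B) F"
  shows "((\<lambda>y. det (f y)) \<longlongrightarrow> det B) F"
  unfolding det_def by (intro tendsto_intros assms)

lemma tendsto_matrix_inv:
  fixes f :: "'a \<Rightarrow> real^'n^'n"
  assumes f: "(f \<longlongrightarrow> B) F" and B: "invertible B"
  shows "((\<lambda>y. matrix_inv (f y)) \<longlongrightarrow> matrix_inv B) F"
proof -
  have det: "det B \<noteq> 0"
    using B by (simp add: invertible_det_nz)
  have if_lim: "((\<lambda>y. if c then t else f y $ i $ j) \<longlongrightarrow> (if c then t else B $ i $ j)) F" for c t i j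
    by (cases c) (auto intro!: tendsto_intros f)
  have "((\<lambda>y. \<chi> k l. det (\<chi> i j. if j = k then axis l 1 $ i else f y $ i $ j) / det (f y))
      \<longlongrightarrow> (\<chi> k l. det (\<chi> i j. if j = k then axis l 1 $ i else B $ i $ j) / det B)) F"
    by (intro tendsto_intros if_lim f det)
  moreover have "\<forall>\<^sub>F y in F. det (f y) \<noteq> 0"
    using tendsto_imp_eventually_ne[OF tendsto_det[OF f] det] .
  then have "\<forall>\<^sub>F y in F. (\<chi> k l. det (\<chi> i j. if j = k then axis l 1 $ i else f y $ i $ j) / det (f y))
      = matrix_inv (f y)"
    by eventually_elim (simp add: matrix_inv_entry_cramer)
  ultimately show ?thesis
    unfolding matrix_inv_entry_cramer[OF det] by (rule Lim_transform_eventually)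
qed

lemma bounded_bilinear_matrix_vector_mult:
  "bounded_bilinear ((*v) :: real^'n^'m \<Rightarrow> real^'n \<Rightarrow> real^'m)"
  unfolding bilinear_conv_bounded_bilinear[symmetric] bilinear_def
  by (auto intro!: linearI simp: algebra_simps scaleR_matrix_vector_assoc matrix_vector_mult_scaleR)

lemma bounded_linear_transpose: "bounded_linear (transpose :: real^'n^'m \<Rightarrow> real^'m^'n)"
  unfolding linear_conv_bounded_linear[symmetric]
  by (auto intro!: linearI simp: transpose_def vec_eq_iff)

section \<open>The derivative of the solution map\<close>

text \<open>
  At a zero of \<open>f\<close> the product rule has only one term, \<open>pr (C p) (f' h)\<close>. The other term would
  involve the increment of \<open>C\<close> times \<open>f\<close>; since \<open>f\<close> is of first order near its zero, this is of higher
  order as soon as \<open>C\<close> is continuous. So no derivative of \<open>C\<close> (below, of a matrix inverse) has to be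
  known.
\<close>

lemma has_derivative_bilinear_at_root:
  assumes "bounded_bilinear pr"
    and C: "(C \<longlongrightarrow> C p) (at p)"
    and f: "(f has_derivative f') (at p)" and root: "f p = 0"
  shows "((\<lambda>y. pr (C y) (f y)) has_derivative (\<lambda>h. pr (C p) (f' h))) (at p)"
proof (rule has_derivativeI)
  interpret bounded_bilinear pr by fact
  have f'_bl: "bounded_linear f'"
    using f by (rule has_derivative_bounded_linear)
  show "bounded_linear (\<lambda>h. pr (C p) (f' h))"
    using bounded_linear_compose[OF bounded_linear_right f'_bl] .
  have "((\<lambda>y. ((f y - f p) - f' (y - p)) /\<^sub>R norm (y - p)) \<longlongrightarrow> 0) (at p)"
    using f by (simp add: has_derivative_at_within)
  from tendsto[OF C this]
  have rem: "((\<lambda>y. pr (C y) (((f y - f p) - f' (y - p)) /\<^sub>R norm (y - p))) \<longlongrightarrow> 0) (at p)"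
    by (simp add: zero_right)
  obtain K where K: "\<And>h. norm (f' h) \<le> norm h * K" and "K \<ge> 0"
    using bounded_linear.nonneg_bounded[OF f'_bl] by blast
  have "norm (f' (y - p) /\<^sub>R norm (y - p)) \<le> K" for y
    using K[of "y - p"] \<open>K \<ge> 0\<close> by (cases "y = p") (auto simp: field_simps)
  then have "Bfun (\<lambda>y. f' (y - p) /\<^sub>R norm (y - p)) (at p)"
    by (intro BfunI always_eventually) blast
  then have "Zfun (\<lambda>y. pr (C y - C p) (f' (y - p) /\<^sub>R norm (y - p))) (at p)"
    using C Zfun_prod_Bfun by (simp add: tendsto_Zfun_iff)
  then have lin: "((\<lambda>y. pr (C y - C p) (f' (y - p) /\<^sub>R norm (y - p))) \<longlongrightarrow> 0) (at p)"
    by (simp add: tendsto_Zfun_iff)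
  \<comment> \<open>remainder of the linearization of \<open>f\<close>, plus the increment of \<open>C\<close> times a bounded difference quotient\<close>
  have "((pr (C y) (f y) - pr (C p) (f p)) - pr (C p) (f' (y - p))) /\<^sub>R norm (y - p)
      = pr (C y) (((f y - f p) - f' (y - p)) /\<^sub>R norm (y - p))
        + pr (C y - C p) (f' (y - p) /\<^sub>R norm (y - p))" for y
    by (simp add: root scaleR_right diff_left diff_right zero_right algebra_simps)
  then show "((\<lambda>y. ((pr (C y) (f y) - pr (C p) (f p)) - pr (C p) (f' (y - p)))
      /\<^sub>R norm (y - p)) \<longlongrightarrow> 0) (at p)"
    using tendsto_add[OF rem lin] by simp
qed

text \<open>
  If \<open>(A\<^sup>T W A) v = 0\<close> then \<open>(A v)\<^sup>T W (A v) = 0\<close>, so \<open>A v = 0\<close> because \<open>W\<close> is definite, and \<open>v = 0\<close>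
  because \<open>A\<close> has full column rank.
\<close>

lemma normal_matrix_invertible:
  fixes A :: "real^'n^'m"
  assumes "rank A = CARD('n)" and "sym_pos_def W"
  shows "invertible (transpose A ** W ** A)"
proof -
  have "v = 0" if "(transpose A ** W ** A) *v v = 0" for v
  proof -
    have "(A *v v) \<bullet> (W *v (A *v v)) = v \<bullet> ((transpose A ** W ** A) *v v)"
      unfolding matrix_vector_mul_assoc[symmetric] transpose_matrix_vector
      by (metis dot_lmul_matrix inner_commute)
    then have "A *v v = 0"
      using that assms(2) unfolding sym_pos_def_def by fastforce
    then show "v = 0"
      using assms(1) matrix_nonfull_linear_equations_eq by blast
  qed
  then show ?thesis
    by (metis invertible_left_inverse matrix_left_invertible_ker)
qed

text \<open>
  Fix the solution \<open>x\<close> at \<open>(A, b)\<close>. The solution at nearby data \<open>(A', b')\<close> is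
  \<open>x + (A'\<^sup>T W A')\<^sup>-\<^sup>1 r(A', b')\<close> with \<open>r(A', b') = A'\<^sup>T W (b' - A' x)\<close>, one step of iterative
  refinement from \<open>x\<close>. The normal equations say that \<open>r\<close> vanishes at \<open>(A, b)\<close>, so the derivative is
  \<open>(A\<^sup>T W A)\<^sup>-\<^sup>1\<close> applied to the derivative of the quadratic map \<open>r\<close>.
\<close>

lemma wls_map_has_derivative:
  fixes A :: "real^'n^'m" and b :: "real^'m" and W :: "real^'m^'m" and L :: "real^'k^'n"
  assumes inv: "invertible (transpose A ** W ** A)"
    and x: "x = wpinv W A *v b" and d: "d = W *v (b - A *v x)"
  shows "(wls_map W L has_derivative
    (\<lambda>(dA, db). transpose L *v (matrix_inv (transpose A ** W ** A)
        *v (transpose dA *v d + transpose A *v (W *v (db - dA *v x)))))) (at (A, b))"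
proof -
  define M where "M = (\<lambda>y :: (real^'n^'m) \<times> (real^'m). transpose (fst y) ** W ** fst y)"
  define r where "r = (\<lambda>y :: (real^'n^'m) \<times> (real^'m).
    transpose (fst y) *v (W *v (snd y - fst y *v x)))"
  note mv = matrix_vector_mul_assoc[symmetric]
  have M_lim: "(M \<longlongrightarrow> M (A, b)) (at (A, b))"
    unfolding M_def matrix_matrix_mult_def transpose_def
    by (auto intro!: tendsto_eq_intros)
  have det_M: "det (M (A, b)) \<noteq> 0"
    using inv by (simp add: M_def invertible_det_nz)
  \<comment> \<open>the normal equations at the unperturbed data\<close>
  have r0: "r (A, b) = 0"
  proof -
    have "transpose A *v (W *v (A *v x)) = (transpose A ** W ** A) *v x"
      by (simp add: mv del: transpose_matrix_vector)
    also have "\<dots> = (transpose A ** W ** A) *v (matrix_inv (transpose A ** W ** A)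
        *v (transpose A *v (W *v b)))"
      by (simp add: x wpinv_def mv del: transpose_matrix_vector)
    also have "\<dots> = transpose A *v (W *v b)"
      unfolding matrix_vector_mul_assoc[of "transpose A ** W ** A"] matrix_inv_cancel[OF inv] by simp
    finally show ?thesis
      by (simp add: r_def matrix_vector_mult_diff_distrib del: transpose_matrix_vector)
  qed
  have tr: "((\<lambda>y :: (real^'n^'m) \<times> (real^'m). transpose (fst y)) has_derivative
      (\<lambda>h. transpose (fst h))) (at (A, b))"
    by (intro bounded_linear_imp_has_derivative bounded_linear_compose[OF bounded_linear_transpose]
        bounded_linear_fst)
  have res: "((\<lambda>y :: (real^'n^'m) \<times> (real^'m). W *v (snd y - fst y *v x)) has_derivative
      (\<lambda>h. W *v (snd h - fst h *v x))) (at (A, b))"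
    by (intro bounded_linear_imp_has_derivative bounded_linear_compose[OF matrix_vector_mul_bounded_linear]
        bounded_linear_sub bounded_linear_snd
        bounded_linear_compose[OF bounded_bilinear.bounded_linear_left[OF bounded_bilinear_matrix_vector_mult]]
        bounded_linear_fst)
  have r_der: "(r has_derivative (\<lambda>h. transpose (fst h) *v d
      + transpose A *v (W *v (snd h - fst h *v x)))) (at (A, b))"
    using bounded_bilinear.FDERIV[OF bounded_bilinear_matrix_vector_mult tr res]
    by (simp add: r_def d add.commute del: transpose_matrix_vector)
  have "((matrix_inv \<circ> M) \<longlongrightarrow> (matrix_inv \<circ> M) (A, b)) (at (A, b))"
    unfolding o_def using M_lim inv by (intro tendsto_matrix_inv) (simp_all add: M_def)
  from has_derivative_bilinear_at_root[OF bounded_bilinear_matrix_vector_mult this r_der r0]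
  have z_der: "((\<lambda>y. matrix_inv (M y) *v r y) has_derivative (\<lambda>h. matrix_inv (M (A, b))
      *v (transpose (fst h) *v d + transpose A *v (W *v (snd h - fst h *v x))))) (at (A, b))"
    by (simp add: o_def)
  have der: "((\<lambda>y. transpose L *v (x + matrix_inv (M y) *v r y)) has_derivative
      (\<lambda>h. transpose L *v (matrix_inv (M (A, b))
      *v (transpose (fst h) *v d + transpose A *v (W *v (snd h - fst h *v x)))))) (at (A, b))"
    using bounded_linear.has_derivative[OF matrix_vector_mul_bounded_linear
        has_derivative_add[OF has_derivative_const[of x] z_der], of "transpose L"]
    by (simp del: transpose_matrix_vector)
  \<comment> \<open>wherever the perturbed normal matrix is invertible, the refinement step from \<open>x\<close> is exact\<close>
  have eq: "transpose L *v (x + matrix_inv (M y) *v r y) = wls_map W L y" if "det (M y) \<noteq> 0" for y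
  proof -
    have inv_y: "invertible (M y)"
      using that by (simp add: invertible_det_nz)
    have "r y = transpose (fst y) *v (W *v snd y) - M y *v x"
      by (simp add: r_def M_def mv matrix_vector_mult_diff_distrib del: transpose_matrix_vector)
    then have "matrix_inv (M y) *v r y
        = matrix_inv (M y) *v (transpose (fst y) *v (W *v snd y)) - matrix_inv (M y) *v (M y *v x)"
      by (simp add: matrix_vector_mult_diff_distrib del: transpose_matrix_vector)
    also have "matrix_inv (M y) *v (M y *v x) = x"
      by (simp add: matrix_vector_mul_assoc matrix_inv_cancel[OF inv_y])
    finally show ?thesis
      by (simp add: wls_map_def M_def mv split_beta del: transpose_matrix_vector)
  qed
  have "\<forall>\<^sub>F y in at (A, b). det (M y) \<noteq> 0"
    using tendsto_imp_eventually_ne[OF tendsto_det[OF M_lim] det_M] .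
  then have "\<forall>\<^sub>F y in at (A, b). transpose L *v (x + matrix_inv (M y) *v r y) = wls_map W L y"
    by eventually_elim (rule eq)
  from has_derivative_transform_eventually[OF der this eq[OF det_M]]
  show ?thesis
    by (simp add: M_def split_def)
qed

text \<open>
  This is the identity \<open>(C \<otimes> B) vec(X) = vec(B X C\<^sup>T)\<close> for the factors that make up \<open>V\<close>: in each of
  the two Kronecker products one factor is a single row, so the result is a vector.
\<close>

lemma kron_vec_cols_mult:
  fixes A dA :: "real^'n^'m" and d :: "real^'m" and x :: "real^'n" and N :: "real^'n^'n"
    and P :: "real^'m^'n"
  shows "(rows_times_one (N \<otimes>\<^sub>K (rowvector d :: real^'m^1))
            - rows_one_times ((rowvector x :: real^'n^1) \<otimes>\<^sub>K P)) *v vec_cols dA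
       = N *v (transpose dA *v d) - P *v (dA *v x)"
proof -
  have "(\<Sum>p\<in>UNIV. (N $ r $ fst p * d $ snd p - x $ fst p * P $ r $ snd p) * dA $ snd p $ fst p)
      = (\<Sum>j\<in>UNIV. N $ r $ j * (\<Sum>i\<in>UNIV. dA $ i $ j * d $ i))
        - (\<Sum>i\<in>UNIV. P $ r $ i * (\<Sum>j\<in>UNIV. dA $ i $ j * x $ j))" for r
  proof -
    have "(\<Sum>p\<in>UNIV. (N $ r $ fst p * d $ snd p - x $ fst p * P $ r $ snd p) * dA $ snd p $ fst p)
        = (\<Sum>j\<in>UNIV. \<Sum>i\<in>UNIV. (N $ r $ j * d $ i - x $ j * P $ r $ i) * dA $ i $ j)"
      unfolding sum.cartesian_product UNIV_Times_UNIV by (simp add: split_def)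
    also have "\<dots> = (\<Sum>j\<in>UNIV. \<Sum>i\<in>UNIV. N $ r $ j * (dA $ i $ j * d $ i))
        - (\<Sum>j\<in>UNIV. \<Sum>i\<in>UNIV. P $ r $ i * (dA $ i $ j * x $ j))"
      by (simp add: left_diff_distrib right_diff_distrib sum_subtractf mult_ac)
    also have "(\<Sum>j\<in>UNIV. \<Sum>i\<in>UNIV. P $ r $ i * (dA $ i $ j * x $ j))
        = (\<Sum>i\<in>UNIV. \<Sum>j\<in>UNIV. P $ r $ i * (dA $ i $ j * x $ j))"
      by (rule sum.swap)
    finally show ?thesis
      by (simp add: sum_distrib_left)
  qed
  then show ?thesis
    by (simp add: vec_eq_iff matrix_vector_mult_def rows_times_one_def rows_one_times_def
        kron_def rowvector_def vec_cols_def transpose_def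
        del: transpose_matrix_vector)
qed

section \<open>Componentwise norms\<close>

lemma infnorm_eq_Max:
  fixes u :: "real^'k"
  shows "infnorm u = Max (range (\<lambda>i. \<bar>u $ i\<bar>))"
  unfolding infnorm_cart by (subst cSup_eq_Max[symmetric]) (auto simp: full_SetCompr_eq)

lemma comp_norm_eq_infnorm:
  fixes y u :: "real^'k"
  assumes "\<And>i. y $ i \<noteq> 0"
  shows "comp_norm y u = infnorm (\<chi> i. u $ i / y $ i)"
  by (simp add: comp_norm_eq_Max[OF assms] infnorm_eq_Max abs_divide)

text \<open>
  On admissible perturbations the least \<open>\<omega>\<close> in the definition exists, being the largest ratio of a
  perturbation entry to a nonzero data entry, and can be used through its defining inequalities.
  Nonzero data are essential: for zero data every \<open>\<omega>\<close>, however negative, satisfies the inequalities,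
  so there is no least one.
\<close>

lemma data_norm_le_iff:
  fixes A dA :: "real^'n^'m" and b db :: "real^'m"
  assumes adm: "admissible A b dA db" and nz: "A \<noteq> 0 \<or> b \<noteq> 0"
  shows "data_norm A b dA db \<le> \<omega> \<longleftrightarrow> \<bar>dA\<bar> \<le> \<omega> *\<^sub>R \<bar>A\<bar> \<and> \<bar>db\<bar> \<le> \<omega> *\<^sub>R \<bar>b\<bar>"
proof -
  \<comment> \<open>all ratios of perturbation entries to nonzero data entries; the least bound is their maximum\<close>
  define R where "R = (\<lambda>(i, j). \<bar>dA $ i $ j\<bar> / \<bar>A $ i $ j\<bar>) ` {(i, j). A $ i $ j \<noteq> 0}
    \<union> (\<lambda>i. \<bar>db $ i\<bar> / \<bar>b $ i\<bar>) ` {i. b $ i \<noteq> 0}"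
  have fin: "finite R"
    unfolding R_def by simp
  have ne: "R \<noteq> {}"
    using nz by (auto simp: R_def vec_eq_iff)
  have mat_iff: "\<bar>dA $ i $ j\<bar> \<le> t * \<bar>A $ i $ j\<bar>
      \<longleftrightarrow> (A $ i $ j \<noteq> 0 \<longrightarrow> \<bar>dA $ i $ j\<bar> / \<bar>A $ i $ j\<bar> \<le> t)" for i j t
    using adm by (cases "A $ i $ j = 0") (simp_all add: admissible_def pos_divide_le_eq)
  have vec_iff: "\<bar>db $ i\<bar> \<le> t * \<bar>b $ i\<bar> \<longleftrightarrow> (b $ i \<noteq> 0 \<longrightarrow> \<bar>db $ i\<bar> / \<bar>b $ i\<bar> \<le> t)" for i t
    using adm by (cases "b $ i = 0") (simp_all add: admissible_def pos_divide_le_eq)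
  have bound_iff: "\<bar>dA\<bar> \<le> t *\<^sub>R \<bar>A\<bar> \<and> \<bar>db\<bar> \<le> t *\<^sub>R \<bar>b\<bar> \<longleftrightarrow> Max R \<le> t" for t
  proof -
    have "\<bar>dA\<bar> \<le> t *\<^sub>R \<bar>A\<bar> \<and> \<bar>db\<bar> \<le> t *\<^sub>R \<bar>b\<bar> \<longleftrightarrow> (\<forall>\<rho>\<in>R. \<rho> \<le> t)"
      by (auto simp: R_def less_eq_vec_def abs_vec_def mat_iff vec_iff)
    then show ?thesis
      using fin ne by simp
  qed
  have "data_norm A b dA db = Max R"
    unfolding data_norm_def bound_iff by (auto intro: Least_equality)
  then show ?thesis
    by (simp add: bound_iff)
qed

section \<open>The condition number of a differentiable map\<close>

lemma abs_mult_vector_le: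
  fixes P :: "real^'n^'m"
  assumes "\<bar>u\<bar> \<le> w"
  shows "\<bar>(P *v u) $ r\<bar> \<le> (\<bar>P\<bar> *v w) $ r"
proof -
  have "\<bar>P $ r $ j * u $ j\<bar> \<le> \<bar>P $ r $ j\<bar> * w $ j" for j
    using assms by (simp add: abs_mult less_eq_vec_def abs_vec_def mult_left_mono)
  then show ?thesis
    unfolding matrix_vector_mult_def abs_vec_def vec_lambda_beta
    by (intro order_trans[OF sum_abs] sum_mono)
qed

text \<open>
  The derivative is linear in the entries of the perturbation, and the unit perturbations are the
  ones that satisfy \<open>\<bar>dA\<bar> \<le> \<bar>A\<bar>\<close> and \<open>\<bar>db\<bar> \<le> \<bar>b\<bar>\<close> with equality in some nonzero entry. Hence
  \<open>\<bar>P\<bar> vec(\<bar>A\<bar>) + \<bar>Q\<bar> \<bar>b\<bar>\<close> bounds the modulus of the derivative in every component at once. A bound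
  on a single component is attained by giving each entry of \<open>\<plusminus>\<bar>A\<bar>\<close> and \<open>\<plusminus>\<bar>b\<bar>\<close> the sign of its coefficient,
  and choosing a component in which the bound is largest relative to \<open>y\<close> gives the maximum.
\<close>

lemma comp_cond_eq_infnorm:
  fixes A :: "real^'n^'m" and b :: "real^'m" and y :: "real^'k"
    and P :: "real^('n \<times> 'm)^'k" and Q :: "real^'m^'k"
  assumes der: "(g has_derivative (\<lambda>(dA, db). P *v vec_cols dA + Q *v db)) (at (A, b))"
    and nz: "A \<noteq> 0 \<or> b \<noteq> 0" and y: "\<And>i. y $ i \<noteq> 0"
  shows "comp_cond y g A b
    = infnorm (\<chi> r. (\<bar>P\<bar> *v vec_cols \<bar>A\<bar> + \<bar>Q\<bar> *v \<bar>b\<bar>) $ r / y $ r)"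
proof -
  define c where "c = \<bar>P\<bar> *v vec_cols \<bar>A\<bar> + \<bar>Q\<bar> *v \<bar>b\<bar>"
  have D: "frechet_derivative g (at (A, b)) (dA, db) = P *v vec_cols dA + Q *v db" for dA db
    using frechet_derivative_at[OF der, symmetric] by simp
  have upper: "comp_norm y (P *v vec_cols dA + Q *v db) \<le> infnorm (\<chi> r. c $ r / y $ r)"
    if adm: "admissible A b dA db" and unit: "data_norm A b dA db = 1" for dA db
  proof -
    have le: "\<bar>dA\<bar> \<le> \<bar>A\<bar>" "\<bar>db\<bar> \<le> \<bar>b\<bar>"
      using data_norm_le_iff[OF adm nz, of 1] unit by simp_all
    have "\<bar>vec_cols dA\<bar> \<le> vec_cols \<bar>A\<bar>"
      using le(1) by (simp add: less_eq_vec_def abs_vec_def vec_cols_def)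
    then have bound: "\<bar>(P *v vec_cols dA + Q *v db) $ r\<bar> \<le> \<bar>c $ r\<bar>" for r
      using abs_mult_vector_le[of "vec_cols dA" "vec_cols \<bar>A\<bar>" P r] abs_mult_vector_le[OF le(2), of Q r]
      by (simp add: c_def)
    have "\<bar>(P *v vec_cols dA + Q *v db) $ r / y $ r\<bar> \<le> infnorm (\<chi> r. c $ r / y $ r)" for r
      using divide_right_mono[OF bound[of r], of "\<bar>y $ r\<bar>"]
        component_le_infnorm_cart[of "\<chi> r. c $ r / y $ r" r]
      by (simp add: abs_divide)
    then show ?thesis
      unfolding comp_norm_eq_infnorm[OF y] infnorm_eq_Max[of "\<chi> r. (P *v vec_cols dA + Q *v db) $ r / y $ r"]
      by auto
  qed
  have "infnorm (\<chi> r. c $ r / y $ r) \<in> range (\<lambda>r. \<bar>(\<chi> r. c $ r / y $ r) $ r\<bar>)"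
    unfolding infnorm_eq_Max by (intro Max_in) auto
  \<comment> \<open>a component that decides the maximum; the extremal perturbation follows the signs of its row\<close>
  then obtain r where r: "infnorm (\<chi> r. c $ r / y $ r) = \<bar>c $ r / y $ r\<bar>"
    by auto
  define dA :: "real^'n^'m" where "dA = (\<chi> i j. if P $ r $ (j, i) < 0 then - \<bar>A $ i $ j\<bar> else \<bar>A $ i $ j\<bar>)"
  define db :: "real^'m" where "db = (\<chi> i. if Q $ r $ i < 0 then - \<bar>b $ i\<bar> else \<bar>b $ i\<bar>)"
  have adm: "admissible A b dA db"
    by (simp add: admissible_def dA_def db_def)
  have abs_eq: "\<bar>dA\<bar> = \<bar>A\<bar>" "\<bar>db\<bar> = \<bar>b\<bar>"
    by (simp_all add: vec_eq_iff abs_vec_def dA_def db_def)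
  have unit: "data_norm A b dA db = 1"
  proof (rule antisym)
    show "data_norm A b dA db \<le> 1"
      using data_norm_le_iff[OF adm nz, of 1] by (simp add: abs_eq)
    have le: "\<bar>A\<bar> \<le> data_norm A b dA db *\<^sub>R \<bar>A\<bar>" "\<bar>b\<bar> \<le> data_norm A b dA db *\<^sub>R \<bar>b\<bar>"
      using data_norm_le_iff[OF adm nz, of "data_norm A b dA db"] by (simp_all add: abs_eq)
    have one_le: "1 \<le> t" if "\<bar>a\<bar> \<le> t * \<bar>a\<bar>" and "a \<noteq> 0" for a t :: real
      using that mult_right_le_imp_le[of 1 "\<bar>a\<bar>" t] by simp
    have "(\<exists>i j. A $ i $ j \<noteq> 0) \<or> (\<exists>i. b $ i \<noteq> 0)"
      using nz by (auto simp: vec_eq_iff)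
    then show "1 \<le> data_norm A b dA db"
      using le by (auto simp: less_eq_vec_def abs_vec_def intro: one_le)
  qed
  have "P $ r $ p * vec_cols dA $ p = \<bar>P $ r $ p\<bar> * vec_cols \<bar>A\<bar> $ p" for p
    by (cases p) (simp add: vec_cols_def dA_def abs_vec_def)
  moreover have "Q $ r $ i * db $ i = \<bar>Q $ r $ i\<bar> * \<bar>b\<bar> $ i" for i
    by (simp add: db_def abs_vec_def)
  ultimately have "(P *v vec_cols dA + Q *v db) $ r = c $ r"
    by (simp add: c_def matrix_vector_mult_def abs_vec_def)
  then have "infnorm (\<chi> r. c $ r / y $ r) \<le> comp_norm y (P *v vec_cols dA + Q *v db)"
    unfolding comp_norm_eq_infnorm[OF y] r
    using component_le_infnorm_cart[of "\<chi> r. (P *v vec_cols dA + Q *v db) $ r / y $ r" r] by simp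
  then have attained: "comp_norm y (P *v vec_cols dA + Q *v db) = infnorm (\<chi> r. c $ r / y $ r)"
    using upper[OF adm unit] by simp
  show ?thesis
    unfolding comp_cond_def D c_def[symmetric]
  proof (rule Greatest_equality)
    show "\<exists>dA db. admissible A b dA db \<and> data_norm A b dA db = 1
        \<and> infnorm (\<chi> r. c $ r / y $ r) = comp_norm y (P *v vec_cols dA + Q *v db)"
      using adm unit attained by metis
  qed (use upper in auto)
qed

section \<open>Diagonal scaling, block rows and blocks of columns\<close>

lemma diag_mat_mult_entry:
  fixes v :: "real^'m" and X :: "real^'n^'m"
  shows "(diag_mat v ** X) $ i $ j = v $ i * X $ i $ j"
  by (simp add: matrix_matrix_mult_def diag_mat_def mult_delta_left mult_delta_right)

lemma mult_diag_mat_entry: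
  fixes v :: "real^'n" and X :: "real^'n^'m"
  shows "(X ** diag_mat v) $ i $ j = X $ i $ j * v $ j"
  by (simp add: matrix_matrix_mult_def diag_mat_def mult_delta_left mult_delta_right)

lemma diag_mat_mult_vector: "(diag_mat v *v u) $ i = v $ i * u $ i"
  by (simp add: matrix_vector_mult_def diag_mat_def mult_delta_left mult_delta_right)

lemma matrix_inv_diag_mat:
  fixes y :: "real^'k"
  assumes "\<And>i. y $ i \<noteq> 0"
  shows "matrix_inv (diag_mat y) = diag_mat (\<chi> i. 1 / y $ i)"
proof (rule matrix_inv_unique)
  show "diag_mat y ** diag_mat (\<chi> i. 1 / y $ i) = mat 1"
    using assms by (simp add: vec_eq_iff diag_mat_mult_entry) (simp add: diag_mat_def mat_def)
qed

lemma matrix_diff_ldistrib: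
  fixes X :: "real^'n^'m" and B C :: "real^'p^'n"
  shows "X ** (B - C) = X ** B - X ** C"
  by (simp add: vec_eq_iff matrix_matrix_mult_def right_diff_distrib sum_subtractf)

lemma mult_hblock:
  fixes X :: "real^'m^'k" and B :: "real^'p^'m" and C :: "real^'q^'m"
  shows "X ** hblock B C = hblock (X ** B) (X ** C)"
  by (auto simp: vec_eq_iff matrix_matrix_mult_def hblock_def split: sum.split)

text \<open>
  Column scaling by \<open>u\<close> and \<open>w\<close> turns the absolute row sums of a matrix into its entrywise modulus
  applied to \<open>\<bar>u\<bar>\<close> and \<open>\<bar>w\<bar>\<close>.
\<close>

lemma mat_infnorm_hblock_diag:
  fixes P :: "real^'p^'k" and Q :: "real^'q^'k" and u :: "real^'p" and w :: "real^'q"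
  shows "mat_infnorm (hblock (P ** diag_mat u) (Q ** diag_mat w))
    = infnorm (\<bar>P\<bar> *v \<bar>u\<bar> + \<bar>Q\<bar> *v \<bar>w\<bar>)"
proof -
  have "(\<Sum>s\<in>UNIV. \<bar>hblock (P ** diag_mat u) (Q ** diag_mat w) $ r $ s\<bar>)
      = (\<bar>P\<bar> *v \<bar>u\<bar> + \<bar>Q\<bar> *v \<bar>w\<bar>) $ r" for r
    unfolding UNIV_Plus_UNIV[symmetric]
    by (subst sum.Plus) (simp_all add: hblock_def mult_diag_mat_entry abs_mult
        matrix_vector_mult_def abs_vec_def)
  moreover have "0 \<le> (\<bar>P\<bar> *v \<bar>u\<bar> + \<bar>Q\<bar> *v \<bar>w\<bar>) $ r" for r
    by (simp add: matrix_vector_mult_def abs_vec_def sum_nonneg)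
  ultimately show ?thesis
    unfolding mat_infnorm_eq_Max_row_sum infnorm_eq_Max by simp
qed

text \<open>
  Grouping the columns \<open>(j, i)\<close> of \<open>P\<close> by \<open>j\<close> gives one block for each column of \<open>A\<close>.
\<close>

lemma mult_vec_cols:
  fixes A :: "real^'n^'m" and P :: "real^('n \<times> 'm)^'k"
  shows "P *v vec_cols A = (\<Sum>j\<in>UNIV. (\<chi> r i. P $ r $ (j, i)) *v column j A)"
proof -
  have "(\<Sum>p\<in>UNIV. P $ r $ p * A $ snd p $ fst p)
      = (\<Sum>j\<in>UNIV. \<Sum>i\<in>UNIV. P $ r $ (j, i) * A $ i $ j)" for r
    unfolding sum.cartesian_product UNIV_Times_UNIV by (simp add: split_def)
  then show ?thesis
    by (simp add: vec_eq_iff matrix_vector_mult_def vec_cols_def column_def)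
qed

section \<open>The three expressions for weighted least squares\<close>

theorem corollary9:
  fixes A :: "real^'n^'m" and b :: "real^'m" and W :: "real^'m^'m" and L :: "real^'k^'n"
    and x :: "real^'n" and d :: "real^'m" and V :: "real^('n \<times> 'm)^'n" and Dinv :: "real^'k^'k"
  assumes "CARD('n) \<le> CARD('m)" and "CARD('k) \<le> CARD('n)"
    and "rank A = CARD('n)"
    and "sym_pos_def W"
    and x_def: "x = wpinv W A *v b"
    and d_def: "d = W *v (b - A *v x)"
    and V_def: "V = rows_times_one (matrix_inv (transpose A ** W ** A) \<otimes>\<^sub>K (rowvector d :: real^'m^1))
                    - rows_one_times ((rowvector x :: real^'n^1) \<otimes>\<^sub>K wpinv W A)"
    and Dinv_def: "Dinv = matrix_inv (diag_mat (transpose L *v x))"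
    and "\<forall>i. (transpose L *v x) $ i \<noteq> 0"
  shows "comp_cond (transpose L *v x) (wls_map W L) A b
           = mat_infnorm (Dinv ** transpose L
               ** hblock (V ** diag_mat (vec_cols A)) (wpinv W A ** diag_mat b))
       \<and> comp_cond (transpose L *v x) (wls_map W L) A b
           = infnorm (\<bar>Dinv\<bar> *v (\<bar>transpose L ** V\<bar> *v vec_cols \<bar>A\<bar>
               + \<bar>transpose L ** wpinv W A\<bar> *v \<bar>b\<bar>))
       \<and> comp_cond (transpose L *v x) (wls_map W L) A b
           = infnorm ((\<Sum>j\<in>UNIV.
                 \<bar>Dinv ** transpose L ** matrix_inv (transpose A ** W ** A)
                    ** ((columnvector (axis j 1) :: real^1^'n) ** (rowvector d :: real^'m^1)
                        - (x $ j) *\<^sub>R (transpose A ** W))\<bar> *v \<bar>column j A\<bar>)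
               + \<bar>Dinv ** transpose L ** wpinv W A\<bar> *v \<bar>b\<bar>)"
proof -
  define y where "y = transpose L *v x"
  define N where "N = matrix_inv (transpose A ** W ** A)"
  define S where "S = wpinv W A"
  define c where "c = \<bar>transpose L ** V\<bar> *v vec_cols \<bar>A\<bar> + \<bar>transpose L ** S\<bar> *v \<bar>b\<bar>"
  have y: "y $ i \<noteq> 0" for i
    using assms(9) by (simp add: y_def del: transpose_matrix_vector)
  have Dinv: "Dinv = diag_mat (\<chi> i. 1 / y $ i)"
    using Dinv_def matrix_inv_diag_mat[OF y] by (simp add: y_def)
  have A: "A \<noteq> 0"
    using assms(3) by auto
  \<comment> \<open>\<open>V\<close> and the weighted pseudoinverse are exactly the coefficients of the derivative\<close>
  have V_mult: "V *v vec_cols dA + S *v db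
      = N *v (transpose dA *v d + transpose A *v (W *v (db - dA *v x)))" for dA db
    by (simp add: V_def kron_vec_cols_mult S_def N_def wpinv_def
        matrix_vector_mul_assoc[symmetric] matrix_vector_mult_diff_distrib matrix_vector_right_distrib
        del: transpose_matrix_vector)
  have "transpose L *v (N *v (transpose dA *v d + transpose A *v (W *v (db - dA *v x))))
      = (transpose L ** V) *v vec_cols dA + (transpose L ** S) *v db" for dA db
    unfolding V_mult[symmetric] by (simp only: matrix_vector_right_distrib matrix_vector_mul_assoc)
  then have der: "(wls_map W L has_derivative
      (\<lambda>(dA, db). (transpose L ** V) *v vec_cols dA + (transpose L ** S) *v db)) (at (A, b))"
    using wls_map_has_derivative[OF normal_matrix_invertible[OF assms(3,4)] x_def d_def, of L]
    by (simp only: N_def)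
  have cond: "comp_cond y (wls_map W L) A b = infnorm (\<chi> r. c $ r / y $ r)"
    using comp_cond_eq_infnorm[OF der _ y] A by (simp add: c_def)
  have Dinv_entry: "(Dinv ** X) $ r $ s = X $ r $ s / y $ r" for X :: "real^'s^'k" and r s
    by (simp add: Dinv diag_mat_mult_entry)
  have abs_Dinv: "\<bar>Dinv ** X\<bar> *v v = (\<chi> r. (\<bar>X\<bar> *v v) $ r / \<bar>y $ r\<bar>)" for X :: "real^'s^'k" and v
    by (simp add: vec_eq_iff matrix_vector_mult_def abs_vec_def Dinv_entry abs_divide sum_divide_distrib)
  \<comment> \<open>dividing by \<open>y\<close> or by \<open>\<bar>y\<bar>\<close> makes no difference inside the infinity norm\<close>
  have infnorm_c: "infnorm (\<chi> r. c $ r / \<bar>y $ r\<bar>) = infnorm (\<chi> r. c $ r / y $ r)"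
    by (simp add: infnorm_eq_Max abs_divide)
  have rows: "\<bar>Dinv ** (transpose L ** V)\<bar> *v vec_cols \<bar>A\<bar> + \<bar>Dinv ** (transpose L ** S)\<bar> *v \<bar>b\<bar>
      = (\<chi> r. c $ r / \<bar>y $ r\<bar>)"
    by (simp add: abs_Dinv c_def vec_eq_iff add_divide_distrib)
  have first: "infnorm (\<chi> r. c $ r / y $ r)
      = mat_infnorm (Dinv ** transpose L ** hblock (V ** diag_mat (vec_cols A)) (S ** diag_mat b))"
  proof -
    have "\<bar>vec_cols A\<bar> = vec_cols \<bar>A\<bar>"
      by (simp add: vec_eq_iff vec_cols_def abs_vec_def)
    then show ?thesis
      unfolding mult_hblock matrix_mul_assoc mat_infnorm_hblock_diag
      using rows infnorm_c by (simp add: matrix_mul_assoc)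
  qed
  have second: "\<bar>Dinv\<bar> *v c = (\<chi> r. c $ r / \<bar>y $ r\<bar>)"
  proof -
    have "\<bar>Dinv\<bar> = diag_mat (\<chi> i. 1 / \<bar>y $ i\<bar>)"
      by (simp add: Dinv vec_eq_iff abs_vec_def diag_mat_def)
    show ?thesis
      unfolding \<open>\<bar>Dinv\<bar> = _\<close> by (simp add: vec_eq_iff diag_mat_mult_vector)
  qed
  have third: "(\<Sum>j\<in>UNIV. \<bar>Dinv ** transpose L ** N
        ** ((columnvector (axis j 1) :: real^1^'n) ** (rowvector d :: real^'m^1)
            - (x $ j) *\<^sub>R (transpose A ** W))\<bar> *v \<bar>column j A\<bar>)
      = \<bar>Dinv ** (transpose L ** V)\<bar> *v vec_cols \<bar>A\<bar>"
  proof -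
    \<comment> \<open>the block of \<open>V\<close> that multiplies the \<open>j\<close>th column of a perturbation of \<open>A\<close>\<close>
    have V_block: "(N ** ((columnvector (axis j 1) :: real^1^'n) ** (rowvector d :: real^'m^1)
        - (x $ j) *\<^sub>R (transpose A ** W))) $ q $ i = V $ q $ (j, i)" for j q i
    proof -
      have "N ** ((x $ j) *\<^sub>R (transpose A ** W)) = (x $ j) *\<^sub>R S"
        by (simp add: S_def N_def wpinv_def matrix_scalar_ac scalar_matrix_assoc matrix_mul_assoc)
      moreover have "(N ** ((columnvector (axis j 1) :: real^1^'n) ** (rowvector d :: real^'m^1))) $ q $ i
          = N $ q $ j * d $ i"
        by (simp add: matrix_matrix_mult_def columnvector_def rowvector_def axis_def
            mult_delta_left mult_delta_right)
      ultimately show ?thesis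
        by (simp add: matrix_diff_ldistrib V_def N_def S_def rows_times_one_def rows_one_times_def
            kron_def rowvector_def)
    qed
    have "(Dinv ** transpose L ** (N ** ((columnvector (axis j 1) :: real^1^'n) ** (rowvector d :: real^'m^1)
        - (x $ j) *\<^sub>R (transpose A ** W)))) $ r $ i
        = (Dinv ** transpose L ** V) $ r $ (j, i)" for j r i
      unfolding matrix_matrix_mult_def[of "Dinv ** transpose L"] vec_lambda_beta V_block ..
    then have "\<bar>Dinv ** transpose L ** N ** ((columnvector (axis j 1) :: real^1^'n)
          ** (rowvector d :: real^'m^1) - (x $ j) *\<^sub>R (transpose A ** W))\<bar>
        = (\<chi> r i. \<bar>Dinv ** (transpose L ** V)\<bar> $ r $ (j, i))" for j
      by (simp add: vec_eq_iff abs_vec_def matrix_mul_assoc)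
    moreover have "\<bar>column j A\<bar> = column j \<bar>A\<bar>" for j
      by (simp add: vec_eq_iff column_def abs_vec_def)
    ultimately show ?thesis
      by (simp add: mult_vec_cols)
  qed
  show ?thesis
    unfolding y_def[symmetric] N_def[symmetric] S_def[symmetric] c_def[symmetric] cond third
    unfolding second infnorm_c first[symmetric] rows[unfolded matrix_mul_assoc] matrix_mul_assoc by simp
qed

end
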